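(* Let $T$ be a tree of order at least $2$. Then (i) $d_g'(T)=2$ if and only if $T$ has a perfect matching, and (ii) $d_g(T)=1$.
   Context: For a vertex $x$, $N[x]$ denotes its closed neighborhood. The domatic number game on a graph $G$ with palette $[k]=\{1,\dots,k\}$: two players, Alice and Bob, alternately choose a previously unchosen vertex of $G$ and assign it a color from $[k]$, until every vertex has been colored. Let $V_i$ be the set of vertices colored $i$. Alice wins if every $V_i$ ($i\in[k]$) is a dominating set of $G$, i.e. for every vertex $x$ and every color $c\in[k]$ some vertex of $N[x]$ has color $c$; otherwise Bob wins. In the $A$-game Alice moves first; in the $B$-game Bob moves first. The game domatic number $d_g(G)$ is the largest $k$ for which Alice has a winning strategy in the $A$-game with palette $[k]$, and the delayed game domatic number $d_g'(G)$ is the largest $k$ for which Alice has a winning strategy in the $B$-game with palette $[k]$. *)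

theory Defs
  imports "Graph_Theory.Digraph_Component" "HOL-Library.Disjoint_Sets"
begin

section \<open>Trees and perfect matchings\<close>

text \<open>
  A finite simple graph is a \<^locale>\<open>pair_graph\<close>: a finite vertex set with a symmetric,
  irreflexive arc relation, an undirected edge being a pair of opposite arcs. The library constant
  \<^const>\<open>tree\<close> is not the undirected notion, since in a symmetric digraph the two arcs of
  a single edge form a \<^const>\<open>pre_digraph.cycle\<close> of length 2; the cycles of the
  undirected graph are those of length at least 3.
\<close>

definition undirected_tree :: "'a pair_pre_digraph \<Rightarrow> bool" where
  "undirected_tree G \<longleftrightarrow>
     pair_graph G \<and> connected (with_proj G) \<and>
     \<not> (\<exists>p. pre_digraph.cycle (with_proj G) p \<and> 3 \<le> length p)"

definition edges :: "'a pair_pre_digraph \<Rightarrow> 'a set set" where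
  "edges G = {{u, v} | u v. (u, v) \<in> parcs G}"

definition matching :: "'a pair_pre_digraph \<Rightarrow> 'a set set \<Rightarrow> bool" where
  "matching G M \<longleftrightarrow> M \<subseteq> edges G \<and> disjoint M"

definition perfect_matching :: "'a pair_pre_digraph \<Rightarrow> 'a set set \<Rightarrow> bool" where
  "perfect_matching G M \<longleftrightarrow> matching G M \<and> \<Union> M = pverts G"


section \<open>Domination\<close>

definition closed_nbhd :: "'a pair_pre_digraph \<Rightarrow> 'a \<Rightarrow> 'a set" where
  "closed_nbhd G x = insert x {y. (x, y) \<in> parcs G}"

definition dominating_set :: "'a pair_pre_digraph \<Rightarrow> 'a set \<Rightarrow> bool" where
  "dominating_set G D \<longleftrightarrow> D \<subseteq> pverts G \<and> (\<forall>x\<in>pverts G. closed_nbhd G x \<inter> D \<noteq> {})"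


section \<open>The domatic number game\<close>

datatype player = Alice | Bob

text \<open>The moves made so far, in chronological order; \<open>(v, c)\<close> assigns colour \<open>c\<close> to vertex \<open>v\<close>.\<close>

type_synonym 'a play = "('a \<times> nat) list"

definition legal_play :: "'a pair_pre_digraph \<Rightarrow> nat \<Rightarrow> 'a play \<Rightarrow> bool" where
  "legal_play G k p \<longleftrightarrow> set p \<subseteq> pverts G \<times> {1..k} \<and> distinct (map fst p)"

definition finished :: "'a pair_pre_digraph \<Rightarrow> 'a play \<Rightarrow> bool" where
  "finished G p \<longleftrightarrow> fst ` set p = pverts G"

definition colour_class :: "'a play \<Rightarrow> nat \<Rightarrow> 'a set" where
  "colour_class p i = {v. (v, i) \<in> set p}"

definition Alice_wins :: "'a pair_pre_digraph \<Rightarrow> nat \<Rightarrow> 'a play \<Rightarrow> bool" where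
  "Alice_wins G k p \<longleftrightarrow> (\<forall>i\<in>{1..k}. dominating_set G (colour_class p i))"

text \<open>\<open>Alice_to_move s n\<close>: after \<open>n\<close> moves it is Alice's turn, if player \<open>s\<close> started.\<close>

definition Alice_to_move :: "player \<Rightarrow> nat \<Rightarrow> bool" where
  "Alice_to_move s n \<longleftrightarrow> (if s = Alice then even n else odd n)"

text \<open>A strategy maps the history of the game to Alice's next move.\<close>

type_synonym 'a strategy = "'a play \<Rightarrow> 'a \<times> nat"

definition follows :: "player \<Rightarrow> 'a strategy \<Rightarrow> 'a play \<Rightarrow> bool" where
  "follows s \<sigma> p \<longleftrightarrow> (\<forall>n<length p. Alice_to_move s n \<longrightarrow> p ! n = \<sigma> (take n p))"

text \<open>
  The strategy has to provide a legal move whenever Alice is to move in an unfinished game, and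
  all finished games played according to it have to be won by Alice.
\<close>

definition winning_strategy ::
    "player \<Rightarrow> 'a pair_pre_digraph \<Rightarrow> nat \<Rightarrow> 'a strategy \<Rightarrow> bool" where
  "winning_strategy s G k \<sigma> \<longleftrightarrow>
     (\<forall>p. legal_play G k p \<and> follows s \<sigma> p \<longrightarrow>
        (if finished G p then Alice_wins G k p
         else Alice_to_move s (length p) \<longrightarrow> legal_play G k (p @ [\<sigma> p])))"

text \<open>
  The palette is required to be nonempty. If \<open>G\<close> is finite and nonempty, the maxima below exist:
  Alice wins for \<open>k = 1\<close>, and cannot win once \<open>k\<close> exceeds the order of \<open>G\<close>.
\<close>

definition game_domatic_number :: "'a pair_pre_digraph \<Rightarrow> nat" where
  "game_domatic_number G = (GREATEST k. 1 \<le> k \<and> (\<exists>\<sigma>. winning_strategy Alice G k \<sigma>))"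

definition delayed_game_domatic_number :: "'a pair_pre_digraph \<Rightarrow> nat" where
  "delayed_game_domatic_number G = (GREATEST k. 1 \<le> k \<and> (\<exists>\<sigma>. winning_strategy Bob G k \<sigma>))"

end

theory Submission
  imports Defs
begin

text \<open>Given a perfect matching, Alice as second player answers each move of Bob at the mate of
  his vertex, with the other of two colours; in the end every vertex sees both colours
  (\<open>winning_strategy_pairing\<close>). More than two colours are out of reach, because some
  closed neighbourhood has at most two vertices (\<open>winning_strategy_le_2\<close>).

  Bob wins against two or more colours once a closed neighbourhood is monochromatic
  (\<open>monochromatic_closed_nbhd\<close>). He plays a forcing game with one colour
  \<open>c\<close>: he colours the only uncoloured neighbour of an end vertex \<open>z\<close>
  (\<open>exists_end_vertex\<close>), threatening to give \<open>z\<close> the colour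
  \<open>c\<close> as well, so Alice must give \<open>z\<close> another colour. The edges used up in
  this way are disjoint. If the uncoloured vertices have no perfect matching, then an isolated one
  must turn up, and Bob gives it the colour \<open>c\<close>. If Alice has opened the game, Bob
  takes the colour of her first vertex as \<open>c\<close> and keeps her forced answers away from
  its neighbours, so that its own neighbourhood becomes monochromatic unless he wins earlier.
  \<open>Bob_spoils\<close> covers both cases.\<close>

section \<open>Vertices of degree at most one in forests\<close>

text \<open>Let \<open>z\<close> be the start of a longest path inside \<open>S\<close> that ends in
  \<open>u\<close>. A neighbour of \<open>z\<close> in \<open>S\<close> lies on the path, or it
  would prolong it, and it is the second vertex, or it would close a cycle of length at least 3. If
  \<open>z = u\<close>, the path is trivial and has no second vertex.\<close>

lemma (in pair_graph) exists_end_vertex_path: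
  assumes acyclic: "\<not> (\<exists>p. cycle p \<and> 3 \<le> length p)"
    and S: "S \<subseteq> pverts G" and u: "u \<in> S"
  shows "\<exists>z\<in>S. (\<forall>y\<in>S. \<forall>y'\<in>S. (z, y) \<in> parcs G \<longrightarrow> (z, y') \<in> parcs G \<longrightarrow> y = y') \<and>
           (z = u \<longrightarrow> (\<forall>y\<in>S. (z, y) \<notin> parcs G))"
proof -
  define P where "P = (\<lambda>(z, p). apath z p u \<and> set (awalk_verts z p) \<subseteq> S)"
  have "P (u, [])"
    using S u by (auto simp: P_def apath_Nil_iff)
  moreover have "\<forall>zp. P zp \<longrightarrow> length (snd zp) < card (pverts G)"
    by (auto simp: P_def dest: length_apath_less)
  ultimately obtain zp where zp: "P zp" and maximal: "\<And>zp'. P zp' \<Longrightarrow> length (snd zp') \<le> length (snd zp)"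
    using ex_has_greatest_nat[of P "(u, [])" "\<lambda>zp. length (snd zp)" "card (pverts G)"] by auto
  obtain z p where [simp]: "zp = (z, p)" by (cases zp)
  have path: "apath z p u" and vS: "set (awalk_verts z p) \<subseteq> S"
    using zp by (auto simp: P_def)
  have nbr: "\<exists>r. p = (z, y) # r" if zy: "(z, y) \<in> parcs G" and "y \<in> S" for y
  proof -
    have yz: "(y, z) \<in> parcs G" and "y \<noteq> z"
      using zy arcs_symmetric no_loops' by blast+
    have y_on: "y \<in> set (awalk_verts z p)"
    proof (rule ccontr)
      assume "y \<notin> set (awalk_verts z p)"
      then have "P (y, (y, z) # p)"
        using path vS yz \<open>y \<in> S\<close> by (auto simp: P_def apath_Cons_iff)
      from maximal[OF this] show False by simp
    qed
    have awalk_p: "awalk z p u" using path by (rule awalkI_apath)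
    obtain q r where qr: "p = q @ r" and q: "awalk z q y"
      using awalk_decomp[OF awalk_p y_on] by blast
    have dq: "distinct (awalk_verts z q)"
      using path unfolding qr by (metis apath_append_iff apath_def)
    \<comment> \<open>The arc from \<open>y\<close> back to \<open>z\<close> closes the segment
      \<open>q\<close> to a cycle of length \<open>length q + 1\<close>, so \<open>q\<close> can
      only be a single arc.\<close>
    have "awalk y ((y, z) # q) y"
      using q yz by (simp add: awalk_Cons_iff)
    then have "cycle ((y, z) # q)"
      using dq unfolding cycle_def by force
    with acyclic have "length q < 2" by auto
    moreover have "q \<noteq> []" using q \<open>y \<noteq> z\<close> by (auto simp: awalk_Nil_iff)
    ultimately obtain e where "q = [e]" by (cases q) auto
    with q have "q = [(z, y)]" by (cases e) (auto simp: awalk_simps)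
    with qr show ?thesis by simp
  qed
  have "z \<in> S" using hd_in_awalk_verts(2)[OF path] vS by auto
  moreover have "y = y'" if "y \<in> S" "y' \<in> S" "(z, y) \<in> parcs G" "(z, y') \<in> parcs G" for y y'
    using nbr[OF that(3,1)] nbr[OF that(4,2)] by auto
  moreover have "(z, y) \<notin> parcs G" if "z = u" "y \<in> S" for y
    using nbr[of y] that path apath_nonempty_ends[of z p u] by auto
  ultimately show ?thesis by blast
qed

text \<open>The end vertex has to avoid \<open>W\<close>, since Bob can only play around uncoloured
  vertices. Writing \<open>W \<subseteq> {v}\<close> treats the cases of no special vertex and of
  one special vertex \<open>v\<close> together.\<close>

lemma (in pair_graph) exists_end_vertex:
  assumes acyclic: "\<not> (\<exists>p. cycle p \<and> 3 \<le> length p)"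
    and U: "U \<subseteq> pverts G" "U \<noteq> {}" and W: "W \<subseteq> {v}" "W \<subseteq> pverts G" "U \<inter> W = {}"
  obtains z where "z \<in> U"
    and "\<And>y y'. \<lbrakk>(z, y) \<in> parcs G; (z, y') \<in> parcs G; y \<in> U \<union> W; y' \<in> U \<union> W\<rbrakk> \<Longrightarrow> y = y'"
proof -
  obtain u where "u \<in> U" using U by blast
  obtain z1 where z1: "z1 \<in> U"
    "\<And>y y'. \<lbrakk>(z1, y) \<in> parcs G; (z1, y') \<in> parcs G; y \<in> U; y' \<in> U\<rbrakk> \<Longrightarrow> y = y'"
    using exists_end_vertex_path[OF acyclic U(1) \<open>u \<in> U\<close>] by auto
  show thesis
  proof (cases "W = {}")
    case True
    show thesis using that[OF z1(1)] z1(2) True by auto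
  next
    case False
    then have Wv: "W = {v}" using W by auto
    have S: "U \<union> W \<subseteq> pverts G" and v: "v \<in> U \<union> W" using U W Wv by auto
    obtain z2 where z2: "z2 \<in> U \<union> W"
      "\<And>y y'. \<lbrakk>(z2, y) \<in> parcs G; (z2, y') \<in> parcs G; y \<in> U \<union> W; y' \<in> U \<union> W\<rbrakk> \<Longrightarrow> y = y'"
      "\<And>y. \<lbrakk>z2 = v; (z2, y) \<in> parcs G\<rbrakk> \<Longrightarrow> y \<notin> U \<union> W"
      using exists_end_vertex_path[OF acyclic S v] by auto
    show thesis
    \<comment> \<open>A longest path towards \<open>v\<close> that starts at \<open>v\<close> itself
      shows that \<open>v\<close> has no neighbour in \<open>U\<close>; then an end vertex
      \<open>z1\<close> of \<open>U\<close> alone will do.\<close>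
    proof (cases "z2 = v")
      case True
      have "(z1, v) \<notin> parcs G" using z2(3)[OF True] True z1(1) arcs_symmetric by blast
      then show thesis using that[OF z1(1)] z1(2) Wv by auto
    next
      case False
      then show thesis using that[of z2] z2(1,2) Wv by blast
    qed
  qed
qed


section \<open>Plays\<close>

lemma legal_play_Nil [simp]: "legal_play G k []"
  by (simp add: legal_play_def)

lemma follows_Nil [simp]: "follows s \<sigma> []"
  by (simp add: follows_def)

lemma legal_play_snoc:
  "legal_play G k (p @ [(v, c)]) \<longleftrightarrow>
     legal_play G k p \<and> v \<in> pverts G \<and> v \<notin> fst ` set p \<and> c \<in> {1..k}"
  by (auto simp: legal_play_def)

lemma follows_snoc:
  "follows s \<sigma> (p @ [m]) \<longleftrightarrow> follows s \<sigma> p \<and> (Alice_to_move s (length p) \<longrightarrow> m = \<sigma> p)"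
  by (auto simp: follows_def less_Suc_eq nth_append)

lemma Alice_to_move_Suc: "Alice_to_move s (Suc n) \<longleftrightarrow> \<not> Alice_to_move s n"
  by (simp add: Alice_to_move_def)

lemma legal_play_subset: "legal_play G k p \<Longrightarrow> fst ` set p \<subseteq> pverts G"
  by (auto simp: legal_play_def)

lemma legal_play_colour_unique:
  "\<lbrakk>legal_play G k p; (v, c) \<in> set p; (v, c') \<in> set p\<rbrakk> \<Longrightarrow> c = c'"
  unfolding legal_play_def by (metis eq_key_imp_eq_value)

lemma winning_strategy_legal:
  assumes "winning_strategy s G k \<sigma>" "legal_play G k p" "follows s \<sigma> p"
    "Alice_to_move s (length p)" "\<not> finished G p"
  shows "legal_play G k (p @ [\<sigma> p])"
  using assms by (auto simp: winning_strategy_def)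

text \<open>Playing on from a position consistent with \<open>\<sigma>\<close> reaches a finished
  game, which Alice has won. Bob's moves are arbitrary: any uncoloured vertex with colour 1, which
  is legal by \<open>1 \<le> k\<close>.\<close>

lemma winning_strategy_extend:
  assumes fin: "finite (pverts G)" and win: "winning_strategy s G k \<sigma>" and k: "1 \<le> k"
    and "legal_play G k p" "follows s \<sigma> p"
  obtains q where "legal_play G k q" "set p \<subseteq> set q" "Alice_wins G k q" "finished G q"
proof -
  have "\<exists>q. legal_play G k q \<and> set p \<subseteq> set q \<and> Alice_wins G k q \<and> finished G q"
    using assms(4,5)
  proof (induction "card (pverts G - fst ` set p)" arbitrary: p rule: less_induct)
    case less
    show ?case
    proof (cases "finished G p")
      case True
      then show ?thesis using less.prems win by (auto simp: winning_strategy_def)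
    next
      case False
      then obtain v where v: "v \<in> pverts G" "v \<notin> fst ` set p"
        using legal_play_subset[OF less.prems(1)] by (auto simp: finished_def)
      define m where "m = (if Alice_to_move s (length p) then \<sigma> p else (v, 1))"
      have legal: "legal_play G k (p @ [m])"
        using winning_strategy_legal[OF win less.prems _ False] less.prems(1) v k
        by (auto simp: m_def legal_play_snoc)
      then have "fst m \<in> pverts G - fst ` set p"
        by (cases m) (auto simp: legal_play_snoc)
      then have "card (pverts G - fst ` set (p @ [m])) < card (pverts G - fst ` set p)"
        using fin by (intro psubset_card_mono) auto
      from less.hyps[OF this legal] less.prems(2) show ?thesis
        by (auto simp: follows_snoc m_def)
    qed
  qed
  with that show thesis by blast
qed

text \<open>Colours are never changed, so if all of the closed neighbourhood of \<open>x\<close> had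
  colour \<open>c\<close>, any other colour would fail to dominate \<open>x\<close> at the end of a
  game that Alice wins.\<close>

lemma monochromatic_closed_nbhd:
  assumes fin: "finite (pverts G)" and win: "winning_strategy s G k \<sigma>"
    and k: "2 \<le> k" and p: "legal_play G k p" "follows s \<sigma> p"
    and x: "x \<in> pverts G"
  shows "\<exists>y\<in>closed_nbhd G x. (y, c) \<notin> set p"
proof (rule ccontr)
  assume mono: "\<not> ?thesis"
  obtain q where q: "legal_play G k q" "set p \<subseteq> set q" "Alice_wins G k q"
    using winning_strategy_extend[OF fin win _ p] k by auto
  obtain b where b: "b \<in> {1..k}" "b \<noteq> c"
    using k that[of 1] that[of 2] by (cases "c = 1") auto
  then obtain y where y: "y \<in> closed_nbhd G x" "(y, b) \<in> set q"
    using q(3) x by (fastforce simp: Alice_wins_def dominating_set_def colour_class_def)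
  then have "(y, c) \<in> set q" using mono q(2) by auto
  from legal_play_colour_unique[OF q(1) y(2) this] b(2) show False by simp
qed

text \<open>In a game won by Alice, choosing for each colour a vertex of that colour near
  \<open>x\<close> is injective, because a vertex carries only one colour.\<close>

lemma winning_strategy_card_closed_nbhd:
  assumes fin: "finite (pverts G)" and win: "winning_strategy s G k \<sigma>"
    and x: "x \<in> pverts G" and N: "finite (closed_nbhd G x)"
  shows "k \<le> card (closed_nbhd G x)"
proof (cases "k = 0")
  case False
  then obtain q where q: "legal_play G k q" "Alice_wins G k q"
    using winning_strategy_extend[OF fin win, of "[]"] by auto
  have "\<exists>y\<in>closed_nbhd G x. (y, c) \<in> set q" if "c \<in> {1..k}" for c
    using q(2) x that by (fastforce simp: Alice_wins_def dominating_set_def colour_class_def)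
  then obtain f where f: "\<And>c. c \<in> {1..k} \<Longrightarrow> f c \<in> closed_nbhd G x \<and> (f c, c) \<in> set q"
    by metis
  then have "inj_on f {1..k}"
    by (metis inj_onI legal_play_colour_unique q(1))
  moreover have "f ` {1..k} \<subseteq> closed_nbhd G x" using f by blast
  ultimately show ?thesis
    using card_inj_on_le[of f "{1..k}" "closed_nbhd G x"] N by simp
qed simp

lemma winning_strategy_one:
  assumes "finite (pverts G)"
  shows "\<exists>\<sigma>. winning_strategy s G 1 \<sigma>"
proof
  let ?\<sigma> = "\<lambda>p :: 'a play. (SOME v. v \<in> pverts G - fst ` set p, 1 :: nat)"
  show "winning_strategy s G 1 ?\<sigma>"
    unfolding winning_strategy_def
  proof (intro allI impI)
    fix p assume p: "legal_play G 1 p \<and> follows s ?\<sigma> p"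
    show "if finished G p then Alice_wins G 1 p
          else Alice_to_move s (length p) \<longrightarrow> legal_play G 1 (p @ [?\<sigma> p])"
    proof (cases "finished G p")
      case True
      moreover have "colour_class p 1 = fst ` set p"
        using p by (force simp: colour_class_def legal_play_def)
      ultimately show ?thesis
        by (auto simp: Alice_wins_def dominating_set_def finished_def closed_nbhd_def)
    next
      case False
      then have "\<exists>v. v \<in> pverts G - fst ` set p"
        using p legal_play_subset[of G 1 p] by (auto simp: finished_def)
      from someI_ex[OF this] False p show ?thesis
        by (auto simp: legal_play_snoc)
    qed
  qed
qed


section \<open>The pairing strategy\<close>

lemma (in pair_graph) perfect_matching_mate:
  assumes "perfect_matching G M"
  obtains m where "\<And>v. v \<in> pverts G \<Longrightarrow> (v, m v) \<in> parcs G"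
    and "\<And>v. v \<in> pverts G \<Longrightarrow> m (m v) = v"
proof -
  have M: "M \<subseteq> edges G" "disjoint M" "\<Union> M = pverts G"
    using assms by (auto simp: perfect_matching_def matching_def)
  have "\<exists>w. {v, w} \<in> M \<and> (v, w) \<in> parcs G" if v: "v \<in> pverts G" for v
  proof -
    obtain e where e: "e \<in> M" "v \<in> e" using v M(3) by auto
    then obtain a b where ab: "e = {a, b}" "(a, b) \<in> parcs G"
      using M(1) by (auto simp: edges_def)
    show ?thesis
    proof (cases "v = a")
      case True
      then show ?thesis using e ab by auto
    next
      case False
      then have "v = b" "e = {v, a}" using e ab by auto
      then show ?thesis using e ab arcs_symmetric by auto
    qed
  qed
  then obtain m where m: "\<And>v. v \<in> pverts G \<Longrightarrow> {v, m v} \<in> M \<and> (v, m v) \<in> parcs G"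
    by metis
  have "m (m v) = v" if v: "v \<in> pverts G" for v
  proof -
    have mv: "m v \<in> pverts G" using m[OF v] in_arcsD2 by blast
    \<comment> \<open>Both edges belong to \<open>M\<close> and contain \<open>m v\<close>.\<close>
    have "{v, m v} = {m v, m (m v)}"
      using disjointD[OF M(2), of "{v, m v}" "{m v, m (m v)}"] m[OF v] m[OF mv] by auto
    moreover have "m v \<noteq> v" using m[OF v] no_loops' by fastforce
    ultimately show ?thesis by (metis doubleton_eq_iff)
  qed
  with m that show thesis by blast
qed

lemma (in pair_graph) winning_strategy_pairing:
  assumes "perfect_matching G M"
  shows "\<exists>\<sigma>. winning_strategy Bob G 2 \<sigma>"
proof -
  obtain m where m: "\<And>v. v \<in> pverts G \<Longrightarrow> (v, m v) \<in> parcs G"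
    and mm: "\<And>v. v \<in> pverts G \<Longrightarrow> m (m v) = v"
    using perfect_matching_mate[OF assms] by blast
  \<comment> \<open>The map \<open>3 - c\<close> swaps the colours 1 and 2. Alice moves only after
    an odd number of moves, so \<open>last p\<close> is Bob's latest move.\<close>
  define \<sigma> :: "'a strategy" where "\<sigma> = (\<lambda>p. (m (fst (last p)), 3 - snd (last p)))"
  have m_in: "m v \<in> pverts G" and m_neq: "m v \<noteq> v" if "v \<in> pverts G" for v
    using m[OF that] in_arcsD2 no_loops' by fastforce+
  have paired: "\<forall>(v, c)\<in>set p. (m v, 3 - c) \<in> set p"
    if "legal_play G 2 p" "follows Bob \<sigma> p" "even (length p)" for p
    using that
  proof (induction "length p" arbitrary: p rule: less_induct)
    case less
    show ?case
    proof (cases p rule: rev_cases)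
      case (snoc q' y)
      then obtain q v c where p: "p = q @ [(v, c), y]"
        using less.prems(3) by (cases q' rule: rev_cases) auto
      have "legal_play G 2 ((q @ [(v, c)]) @ [y])" "follows Bob \<sigma> ((q @ [(v, c)]) @ [y])"
        using less.prems p by simp_all
      then have vc: "v \<in> pverts G" "c \<in> {1..2}" and y: "y = (m v, 3 - c)"
        and q: "legal_play G 2 q" "follows Bob \<sigma> q"
        using less.prems(3) p
        by (cases y; auto simp: legal_play_snoc follows_snoc Alice_to_move_def \<sigma>_def
              simp del: append_assoc)+
      have "\<forall>(v, c)\<in>set q. (m v, 3 - c) \<in> set q"
        using less.hyps[OF _ q] less.prems(3) p by simp
      then show ?thesis using vc mm[OF vc(1)] unfolding p y by auto
    qed simp
  qed
  have "winning_strategy Bob G 2 \<sigma>"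
    unfolding winning_strategy_def
  proof (intro allI impI)
    fix p assume "legal_play G 2 p \<and> follows Bob \<sigma> p"
    then have p: "legal_play G 2 p" "follows Bob \<sigma> p" by auto
    \<comment> \<open>By the invariant before Bob's move, the mate of his vertex \<open>v\<close> is
      still free: had it been coloured, \<open>v\<close> would have been coloured too. Hence a
      finished game has even length and the invariant applies to it.\<close>
    have reply: "\<not> finished G p \<and> legal_play G 2 (p @ [\<sigma> p])" if odd: "odd (length p)"
    proof -
      obtain q v c where q: "p = q @ [(v, c)]"
        using odd by (cases p rule: rev_cases) auto
      have vc: "v \<in> pverts G" "v \<notin> fst ` set q" "c \<in> {1..2}" and lq: "legal_play G 2 q" "follows Bob \<sigma> q"
        using p unfolding q by (auto simp: legal_play_snoc follows_snoc)
      have "m v \<notin> fst ` set q"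
      proof
        assume "m v \<in> fst ` set q"
        then have "m (m v) \<in> fst ` set q"
          using paired[OF lq] odd q by force
        then show False using mm vc by simp
      qed
      then have "m v \<in> pverts G - fst ` set p"
        using m_in[OF vc(1)] m_neq[OF vc(1)] q by auto
      then show ?thesis
        using p(1) vc(3) q by (auto simp: finished_def legal_play_snoc \<sigma>_def simp del: append_assoc)
    qed
    show "if finished G p then Alice_wins G 2 p
          else Alice_to_move Bob (length p) \<longrightarrow> legal_play G 2 (p @ [\<sigma> p])"
    proof (cases "finished G p")
      case True
      then have even: "even (length p)" using reply by blast
      have "\<exists>y\<in>closed_nbhd G x. (y, i) \<in> set p" if i: "i \<in> {1..2}" and x: "x \<in> pverts G" for i x
      proof -
        obtain c where c: "(x, c) \<in> set p" using True x by (fastforce simp: finished_def)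
        then have "c \<in> {1..2}" using p(1) by (auto simp: legal_play_def)
        then have "i = c \<or> i = 3 - c" using i by auto
        moreover have "(m x, 3 - c) \<in> set p" using paired[OF p even] c by auto
        ultimately show ?thesis using c m[OF x] by (auto simp: closed_nbhd_def)
      qed
      moreover have "colour_class p i \<subseteq> pverts G" for i
        using p(1) by (auto simp: colour_class_def legal_play_def)
      ultimately have "Alice_wins G 2 p"
        by (fastforce simp: Alice_wins_def dominating_set_def colour_class_def)
      then show ?thesis using True by simp
    qed (use reply in \<open>auto simp: Alice_to_move_def\<close>)
  qed
  then show ?thesis by blast
qed


section \<open>Bob's strategy\<close>

lemma matching_insert:
  assumes "matching G M" "{z, w} \<in> edges G" "z \<notin> \<Union> M" "w \<notin> \<Union> M"
  shows "matching G (insert {z, w} M)"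
  using assms by (auto simp: matching_def disjoint_def)

text \<open>
  On the forest induced by the uncoloured vertices, Bob repeatedly picks an end vertex \<open>z\<close> and
  gives its neighbour \<open>w\<close> the colour \<open>c\<close>. All neighbours of \<open>z\<close> then have colour \<open>c\<close>, so Alice
  must answer at \<open>z\<close>, and \<open>{z, w}\<close> becomes an edge of a matching. Bob succeeds at an isolated
  vertex, which must occur if the forest has no perfect matching. Otherwise the set \<open>W\<close> contains
  Alice's first vertex, of colour \<open>c\<close>; treating \<open>W\<close> as part of the forest when \<open>z\<close> is chosen
  prevents Alice's answers from being adjacent to it, and it ends up with a closed neighbourhood
  of colour \<open>c\<close>.
\<close>

lemma (in pair_graph) Bob_spoils:
  assumes acyclic: "\<not> (\<exists>p. cycle p \<and> 3 \<le> length p)"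
    and win: "winning_strategy s G k \<sigma>" and k: "2 \<le> k" and c: "c \<in> {1..k}"
    and W: "W \<subseteq> {v}" "W \<subseteq> pverts G"
    and "legal_play G k p" "follows s \<sigma> p" "\<not> Alice_to_move s (length p)"
    and "\<forall>x\<in>W. (x, c) \<in> set p"
    and "\<And>x y. \<lbrakk>x \<in> (pverts G - fst ` set p) \<union> W; (x, y) \<in> parcs G\<rbrakk>
           \<Longrightarrow> y \<in> pverts G - fst ` set p \<or> (y, c) \<in> set p"
    and "W = {} \<Longrightarrow> \<not> (\<exists>M. matching G M \<and> \<Union> M = pverts G - fst ` set p)"
  shows False
  using assms(7-)
proof (induction "card (pverts G - fst ` set p)" arbitrary: p rule: less_induct)
  case less
  note p = less.prems(1,2)
  define U where "U = pverts G - fst ` set p"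
  \<comment> \<open>The invariant: a coloured neighbour of \<open>U\<close> or of \<open>W\<close>
    has colour \<open>c\<close>, so the answers of Alice in other colours touch neither set.\<close>
  have nbr: "y \<in> U \<or> (y, c) \<in> set p" if "x \<in> U \<union> W" "(x, y) \<in> parcs G" for x y
    using less.prems(5) that unfolding U_def by blast
  note spoil = monochromatic_closed_nbhd[OF finite_verts win k]
  show False
  proof (cases "U = {}")
    case True
    have "matching G {} \<and> \<Union> {} = pverts G - fst ` set p"
      using True by (auto simp: matching_def U_def)
    \<comment> \<open>The empty matching covers the empty forest, so \<open>W\<close> is nonempty;
      all neighbours of its vertex have received colour \<open>c\<close>.\<close>
    then obtain x where x: "x \<in> W" using less.prems(6) by blast
    then show False
      using spoil[OF p, of x c] W(2) less.prems(4) nbr[of x] True by (auto simp: closed_nbhd_def)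
  next
    case False
    have UW: "U \<subseteq> pverts G" "U \<inter> W = {}" using less.prems(4) by (force simp: U_def)+
    obtain z where z: "z \<in> U"
      and end_vertex: "\<And>y y'. \<lbrakk>(z, y) \<in> parcs G; (z, y') \<in> parcs G; y \<in> U \<union> W; y' \<in> U \<union> W\<rbrakk> \<Longrightarrow> y = y'"
      using exists_end_vertex[OF acyclic UW(1) False W UW(2)] by blast
    have zG: "z \<in> pverts G" using z UW by blast
    show False
    proof (cases "\<exists>w\<in>U. (z, w) \<in> parcs G")
      case False
      \<comment> \<open>All neighbours of \<open>z\<close> already have colour \<open>c\<close>, so
        this move makes its closed neighbourhood monochromatic.\<close>
      let ?p = "p @ [(z, c)]"
      have "legal_play G k ?p" "follows s \<sigma> ?p"
        using p z c less.prems(3) by (auto simp: legal_play_snoc follows_snoc U_def)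
      from spoil[OF this zG, of c] show False
        using nbr[of z] z False by (auto simp: closed_nbhd_def)
    next
      case True
      then obtain w where w: "w \<in> U" and zw: "(z, w) \<in> parcs G" by blast
      have "w \<noteq> z" using zw no_loops' by blast
      \<comment> \<open>Since \<open>w\<close> is the only neighbour of \<open>z\<close> in the
        forest together with \<open>W\<close>, a different colour at \<open>z\<close> will not break
        the invariant.\<close>
      have only_w: "y = w" if "y \<in> U \<union> W" "(y, z) \<in> parcs G" for y
        using end_vertex[OF arcs_symmetric[OF that(2)] zw that(1)] w by blast
      define p1 where "p1 = p @ [(w, c)]"
      have p1: "legal_play G k p1" "follows s \<sigma> p1" "Alice_to_move s (length p1)"
        using p w c less.prems(3)
        by (auto simp: p1_def legal_play_snoc follows_snoc Alice_to_move_Suc U_def)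
      have z_p1: "z \<notin> fst ` set p1" using z \<open>w \<noteq> z\<close> by (auto simp: p1_def U_def)
      have nbr_z: "(y, c) \<in> set p1" if "(z, y) \<in> parcs G" for y
        using nbr[of z y] end_vertex[OF that zw] that z w by (auto simp: p1_def)
      obtain v' b where mv: "\<sigma> p1 = (v', b)" by (cases "\<sigma> p1")
      define p2 where "p2 = p1 @ [(v', b)]"
      have "\<not> finished G p1" using z_p1 zG by (auto simp: finished_def)
      then have p2: "legal_play G k p2" "follows s \<sigma> p2" "\<not> Alice_to_move s (length p2)"
        using winning_strategy_legal[OF win p1] p1 mv
        by (auto simp: p2_def follows_snoc Alice_to_move_Suc)
      show False
      \<comment> \<open>Any other answer loses: either Alice herself gives \<open>z\<close> the
        colour \<open>c\<close>, or Bob does so next.\<close>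
      proof (cases "v' = z \<and> b \<noteq> c")
        case False
        show False
        proof (cases "v' = z")
          case True
          then show False
            using spoil[OF p2(1,2) zG, of c] nbr_z False
            by (auto simp: closed_nbhd_def p2_def)
        next
          case False
          then have "legal_play G k (p2 @ [(z, c)])" "follows s \<sigma> (p2 @ [(z, c)])"
            using p2 zG z_p1 c by (auto simp: legal_play_snoc follows_snoc p2_def simp del: append_assoc)
          from spoil[OF this zG, of c] show False
            using nbr_z by (auto simp: closed_nbhd_def p2_def)
        qed
      next
        case True
        have U2: "pverts G - fst ` set p2 = U - {w, z}"
          using True by (auto simp: p2_def p1_def U_def)
        show False
        proof (rule less.hyps[OF _ p2])
          show "card (pverts G - fst ` set p2) < card (pverts G - fst ` set p)"
            unfolding U2 U_def[symmetric]
            using z finite_subset[OF UW(1) finite_verts] by (intro psubset_card_mono) auto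
          show "\<forall>x\<in>W. (x, c) \<in> set p2"
            using less.prems(4) by (auto simp: p2_def p1_def)
          show "y \<in> pverts G - fst ` set p2 \<or> (y, c) \<in> set p2"
            if "x \<in> (pverts G - fst ` set p2) \<union> W" "(x, y) \<in> parcs G" for x y
          proof -
            have "x \<in> U \<union> W" "x \<noteq> w" using that(1) U2 w UW(2) by auto
            then have "y \<noteq> z" using only_w that(2) by blast
            then show ?thesis
              using nbr[OF \<open>x \<in> U \<union> W\<close> that(2)] unfolding U2 by (auto simp: p2_def p1_def)
          qed
          show "\<not> (\<exists>M. matching G M \<and> \<Union> M = pverts G - fst ` set p2)" if "W = {}"
          proof
            assume "\<exists>M. matching G M \<and> \<Union> M = pverts G - fst ` set p2"
            then obtain M where M: "matching G M" "\<Union> M = U - {w, z}" using U2 by auto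
            \<comment> \<open>Adding the edge just played would turn a perfect matching of the
              remaining forest into one of \<open>U\<close>.\<close>
            have "matching G (insert {z, w} M)"
              using M zw by (intro matching_insert) (auto simp: edges_def)
            moreover have "\<Union> (insert {z, w} M) = U" using M(2) z w by auto
            ultimately show False using less.prems(6)[OF that] unfolding U_def by blast
          qed
        qed
      qed
    qed
  qed
qed

text \<open>Bob's forcing game starts from Alice's opening move: its vertex forms \<open>W\<close>
  and its colour becomes \<open>c\<close>. As \<open>W\<close> is nonempty, the condition on
  matchings is vacuous.\<close>

lemma (in pair_graph) no_winning_strategy_Alice:
  assumes acyclic: "\<not> (\<exists>p. cycle p \<and> 3 \<le> length p)" and ne: "pverts G \<noteq> {}" and k: "2 \<le> k"
  shows "\<not> winning_strategy Alice G k \<sigma>"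
proof
  assume win: "winning_strategy Alice G k \<sigma>"
  obtain v c where vc: "\<sigma> [] = (v, c)" by (cases "\<sigma> []")
  have "legal_play G k ([] @ [\<sigma> []])"
    using ne by (intro winning_strategy_legal[OF win]) (auto simp: Alice_to_move_def finished_def)
  then have legal: "legal_play G k [(v, c)]" using vc by simp
  then have v: "v \<in> pverts G" and c: "c \<in> {1..k}" by (auto simp: legal_play_def)
  show False
  proof (rule Bob_spoils[OF acyclic win k c, of "{v}" v "[(v, c)]"])
    show "follows Alice \<sigma> [(v, c)]" using vc by (simp add: follows_def)
    show "y \<in> pverts G - fst ` set [(v, c)] \<or> (y, c) \<in> set [(v, c)]" if "(x, y) \<in> parcs G" for x y
      using that in_arcsD2 by fastforce
  qed (use legal v in \<open>auto simp: Alice_to_move_def\<close>)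
qed

text \<open>Bob starts on the uncoloured graph with \<open>W\<close> empty; \<open>undefined\<close>
  is a dummy for the absent special vertex, and 1 serves as his colour.\<close>

lemma (in pair_graph) perfect_matching_if_winning_strategy_Bob:
  assumes acyclic: "\<not> (\<exists>p. cycle p \<and> 3 \<le> length p)" and k: "2 \<le> k"
    and win: "winning_strategy Bob G k \<sigma>"
  shows "\<exists>M. perfect_matching G M"
proof (rule ccontr)
  assume no: "\<not> ?thesis"
  show False
  proof (rule Bob_spoils[OF acyclic win k, of 1 "{}" undefined "[]"])
    show "y \<in> pverts G - fst ` set [] \<or> (y, 1) \<in> set []" if "(x, y) \<in> parcs G" for x y
      using that in_arcsD2 by fastforce
  qed (use no k in \<open>auto simp: Alice_to_move_def perfect_matching_def\<close>)
qed

text \<open>The closed neighbourhood of an end vertex has at most two vertices, too few to show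
  three colours.\<close>

lemma (in pair_graph) winning_strategy_le_2:
  assumes acyclic: "\<not> (\<exists>p. cycle p \<and> 3 \<le> length p)" and ne: "pverts G \<noteq> {}"
    and win: "winning_strategy s G k \<sigma>"
  shows "k \<le> 2"
proof -
  obtain z where z: "z \<in> pverts G"
    and end_vertex: "\<And>y y'. \<lbrakk>(z, y) \<in> parcs G; (z, y') \<in> parcs G; y \<in> pverts G \<union> {}; y' \<in> pverts G \<union> {}\<rbrakk>
      \<Longrightarrow> y = y'"
    by (rule exists_end_vertex[OF acyclic subset_refl ne, of "{}" undefined]) auto
  have "\<exists>y. closed_nbhd G z \<subseteq> {z, y}"
  proof (cases "\<exists>y. (z, y) \<in> parcs G")
    case True
    then obtain y where "(z, y) \<in> parcs G" ..
    then have "closed_nbhd G z \<subseteq> {z, y}"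
      using end_vertex in_arcsD2 by (fastforce simp: closed_nbhd_def)
    then show ?thesis ..
  qed (auto simp: closed_nbhd_def)
  then obtain y where y: "closed_nbhd G z \<subseteq> {z, y}" ..
  have "card {z, y} \<le> 2" by (simp add: card_insert_if)
  then have "finite (closed_nbhd G z)" "card (closed_nbhd G z) \<le> 2"
    using finite_subset[OF y] card_mono[OF _ y] by simp_all
  then show ?thesis
    using winning_strategy_card_closed_nbhd[OF finite_verts win z] by linarith
qed

theorem theorem5p2:
  fixes T :: "'a pair_pre_digraph"
  assumes "undirected_tree T"
    and "card (pverts T) \<ge> 2"
  shows "(delayed_game_domatic_number T = 2 \<longleftrightarrow> (\<exists>M. perfect_matching T M)) \<and>
         game_domatic_number T = 1"
proof -
  interpret pair_graph T using assms(1) by (simp add: undirected_tree_def)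
  have acyclic: "\<not> (\<exists>p. cycle p \<and> 3 \<le> length p)"
    using assms(1) by (simp add: undirected_tree_def)
  have ne: "pverts T \<noteq> {}" using assms(2) by auto
  note one = winning_strategy_one[OF finite_verts]
  have "game_domatic_number T = 1"
    unfolding game_domatic_number_def
  proof (rule Greatest_equality)
    show "k \<le> 1" if "1 \<le> k \<and> (\<exists>\<sigma>. winning_strategy Alice T k \<sigma>)" for k
      using that no_winning_strategy_Alice[OF acyclic ne, of k] by force
  qed (use one in auto)
  moreover have "delayed_game_domatic_number T = 2" if "perfect_matching T M" for M
    unfolding delayed_game_domatic_number_def
    using winning_strategy_pairing[OF that] winning_strategy_le_2[OF acyclic ne]
    by (intro Greatest_equality) auto
  \<comment> \<open>The converse of (i) by contraposition: the exact value 1 excludes 2.\<close>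
  moreover have "delayed_game_domatic_number T = 1" if "\<not> (\<exists>M. perfect_matching T M)"
    unfolding delayed_game_domatic_number_def
  proof (rule Greatest_equality)
    show "k \<le> 1" if k: "1 \<le> k \<and> (\<exists>\<sigma>. winning_strategy Bob T k \<sigma>)" for k
      using k perfect_matching_if_winning_strategy_Bob[OF acyclic, of k]
        \<open>\<not> (\<exists>M. perfect_matching T M)\<close> by force
  qed (use one in auto)
  ultimately show ?thesis by force
qed

end
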